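(* Let $G$ be an $\mathrm{AT}$-free graph with vertex set $V$, and let $\mathcal{C}$ be the collection of convex sets of $G$. Then $(V,\mathcal{C})$ is a convex geometry.
   Context: Graphs are finite and simple. For a vertex $x$, $N(x)$ is its neighborhood and $N[x]=N(x)\cup\{x\}$. An asteroidal triple is a set of three vertices such that every pair of them is connected by a path avoiding the closed neighborhood of the third; a graph is $\mathrm{AT}$-free if it has no asteroidal triple. For vertices $x,y$, a vertex $z$ is between $x$ and $y$ if there is a path from $z$ to $x$ all of whose vertices avoid $N[y]$ and a path from $z$ to $y$ all of whose vertices avoid $N[x]$; $I(x,y)$ denotes the set of vertices between $x$ and $y$. A set $W\subseteq V$ is convex if for all $u,w\in W$ we have $I(u,w)\subseteq W$. For $U\subseteq V$ let $\sigma(U)$ be the intersection of all convex sets containing $U$. A convex geometry on $V$ is a collection $\mathcal{C}$ of subsets of $V$ such that $V,\varnothing\in\mathcal{C}$, $\mathcal{C}$ is closed under intersections, and the anti-exchange property holds: for every $Y\in\mathcal{C}$ and distinct $x,z\notin Y$, if $z\in\sigma(Y\cup\{x\})$ then $x\notin\sigma(Y\cup\{z\})$. *)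

theory Defs
  imports "Graph_Theory.Pair_Digraph" "Graph_Theory.Vertex_Walk"
begin

text \<open>
  A finite simple graph is a \<^verbatim>\<open>pair_graph\<close>: a finite, loop-free digraph with a symmetric
  arc relation. Paths are the vertex paths \<^verbatim>\<open>vpath\<close>, that is, nonempty lists of distinct
  vertices of the graph in which consecutive vertices are adjacent.
\<close>

definition neighborhood :: "'a pair_pre_digraph \<Rightarrow> 'a \<Rightarrow> 'a set" where
  "neighborhood G x = {y. (x, y) \<in> parcs G}"

definition closed_neighborhood :: "'a pair_pre_digraph \<Rightarrow> 'a \<Rightarrow> 'a set" where
  "closed_neighborhood G x = neighborhood G x \<union> {x}"

text \<open>All vertices of the path, its two endpoints included, have to avoid \<open>S\<close>.\<close>

definition connected_avoiding :: "'a pair_pre_digraph \<Rightarrow> 'a set \<Rightarrow> 'a \<Rightarrow> 'a \<Rightarrow> bool" where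
  "connected_avoiding G S x y \<longleftrightarrow>
     (\<exists>p. vpath p (with_proj G) \<and> hd p = x \<and> last p = y \<and> set p \<inter> S = {})"

text \<open>
  Since \<open>T\<close> has exactly three elements, the quantifier over \<open>x\<close>, \<open>y\<close>, \<open>z\<close> ranges over all
  enumerations of \<open>T\<close>, and hence over all choices of a pair and of the remaining third vertex.
\<close>

definition asteroidal_triple :: "'a pair_pre_digraph \<Rightarrow> 'a set \<Rightarrow> bool" where
  "asteroidal_triple G T \<longleftrightarrow>
     T \<subseteq> pverts G \<and> card T = 3 \<and>
     (\<forall>x y z. T = {x, y, z} \<longrightarrow> connected_avoiding G (closed_neighborhood G z) x y)"

definition AT_free :: "'a pair_pre_digraph \<Rightarrow> bool" where
  "AT_free G \<longleftrightarrow> \<not> (\<exists>T. asteroidal_triple G T)"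

definition between :: "'a pair_pre_digraph \<Rightarrow> 'a \<Rightarrow> 'a \<Rightarrow> 'a \<Rightarrow> bool" where
  "between G x y z \<longleftrightarrow>
     connected_avoiding G (closed_neighborhood G y) z x \<and>
     connected_avoiding G (closed_neighborhood G x) z y"

definition between_set :: "'a pair_pre_digraph \<Rightarrow> 'a \<Rightarrow> 'a \<Rightarrow> 'a set" where
  "between_set G x y = {z \<in> pverts G. between G x y z}"

definition convex_set :: "'a pair_pre_digraph \<Rightarrow> 'a set \<Rightarrow> bool" where
  "convex_set G W \<longleftrightarrow> W \<subseteq> pverts G \<and> (\<forall>u\<in>W. \<forall>w\<in>W. between_set G u w \<subseteq> W)"

text \<open>
  The operator \<open>\<sigma>\<close> of a collection \<open>\<C>\<close> of sets is the library's hull operator: \<open>\<sigma>(U)\<close> is the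
  intersection of all members of \<open>\<C>\<close> that contain \<open>U\<close>. In the anti-exchange property the points
  \<open>x\<close> and \<open>z\<close> belong to the ground set \<open>V\<close>. Closure under intersections is for nonempty
  families; the empty intersection is \<open>UNIV\<close> here, and its counterpart \<open>V\<close> is required separately.
\<close>

definition convex_geometry :: "'a set \<Rightarrow> 'a set set \<Rightarrow> bool" where
  "convex_geometry V \<C> \<longleftrightarrow>
     \<C> \<subseteq> Pow V \<and> V \<in> \<C> \<and> {} \<in> \<C> \<and>
     (\<forall>\<F>. \<F> \<subseteq> \<C> \<and> \<F> \<noteq> {} \<longrightarrow> \<Inter>\<F> \<in> \<C>) \<and>
     (\<forall>Y\<in>\<C>. \<forall>x\<in>V - Y. \<forall>z\<in>V - Y.
        x \<noteq> z \<and> z \<in> (\<lambda>W. W \<in> \<C>) hull (Y \<union> {x}) \<longrightarrow> x \<notin> (\<lambda>W. W \<in> \<C>) hull (Y \<union> {z}))"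

end

theory Submission
  imports Defs
begin

text \<open>
  By a chain argument, anti-exchange holds as soon as every convex \<open>Y \<noteq> V\<close> can be extended by a
  single vertex to a convex set. Suppose that \<open>Y\<close> cannot. Then every \<open>x \<notin> Y\<close> has some \<open>y \<in> Y\<close> and
  \<open>z \<notin> Y\<close> between \<open>x\<close> and \<open>y\<close>, so there is an infinite walk \<open>x\<^sub>0, x\<^sub>1, \<dots>\<close> outside \<open>Y\<close> with labels
  \<open>y\<^sub>i \<in> Y\<close> such that \<open>x\<^sub>i\<^sub>+\<^sub>1\<close> is between \<open>x\<^sub>i\<close> and \<open>y\<^sub>i\<close>. Let \<open>C\<^sub>c(a)\<close> be the component of \<open>a\<close> after
  removal of the closed neighborhood of \<open>c\<close>, and call \<open>x\<^sub>i\<^sub>+\<^sub>1\<close> a turn if it separates \<open>y\<^sub>i\<close> from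
  \<open>y\<^sub>i\<^sub>+\<^sub>1\<close>. As long as there is no turn, the component of \<open>x\<^sub>i\<close> containing \<open>y\<^sub>i\<close> shrinks strictly, so
  there are infinitely many turns. From each turn to the next one, the component of \<open>y\<^sub>i\<close> containing
  the turning point shrinks strictly, which is a contradiction.
\<close>

section \<open>Separation by closed neighborhoods\<close>

text \<open>\<open>R c a b\<close> says that \<open>a\<close> and \<open>b\<close> are connected in \<open>V\<close> without the closed neighborhood of \<open>c\<close>;
  thus \<open>R c a a\<close> says that \<open>a\<close> and \<open>c\<close> are distinct and not adjacent. The axiom \<open>avoid\<close> holds
  because a path from \<open>b\<close> to \<open>d\<close> that avoids the closed neighborhood of \<open>c\<close> but meets that of \<open>a\<close>
  connects \<open>a\<close> to \<open>b\<close>.\<close>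

locale separation =
  fixes V :: "'a set" and R :: "'a \<Rightarrow> 'a \<Rightarrow> 'a \<Rightarrow> bool"
  assumes finite_V: "finite V"
    and in_V: "R c a b \<Longrightarrow> a \<in> V"
    and sym: "R c a b \<Longrightarrow> R c b a"
    and trans: "R c a b \<Longrightarrow> R c b d \<Longrightarrow> R c a d"
    and swap: "R c a a \<Longrightarrow> R a c c"
    and avoid: "R c a a \<Longrightarrow> R c b d \<Longrightarrow> \<not> R c a b \<Longrightarrow> R a b d"
    and no_triple: "R c a b \<Longrightarrow> R a b c \<Longrightarrow> \<not> R b a c"
begin

section \<open>Components and betweenness\<close>

definition comp :: "'a \<Rightarrow> 'a \<Rightarrow> 'a set" where
  "comp c a = {u. R c a u}"

definition I :: "'a \<Rightarrow> 'a \<Rightarrow> 'a set" where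
  "I x y = {z. R y z x \<and> R x z y}"

definition cvx :: "'a set \<Rightarrow> bool" where
  "cvx W \<longleftrightarrow> W \<subseteq> V \<and> (\<forall>u\<in>W. \<forall>w\<in>W. I u w \<subseteq> W)"

lemma refl1: "R c a b \<Longrightarrow> R c a a"
  using sym trans by blast

lemma refl2: "R c a b \<Longrightarrow> R c b b"
  using sym trans by blast

lemma finite_comp: "finite (comp c a)"
  by (rule finite_subset[OF _ finite_V]) (auto simp: comp_def dest: sym in_V)

lemma irrefl: "\<not> R c c a" "\<not> R c a c"
  using no_triple refl1 refl2 by blast+

lemma comp_eq: "R c a b \<Longrightarrow> comp c a = comp c b"
  unfolding comp_def using sym trans by blast

lemma I_in_V: "z \<in> I x y \<Longrightarrow> z \<in> V"
  unfolding I_def using in_V by blast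

lemma I_commute: "I x y = I y x"
  unfolding I_def by blast

lemma I_nonadjacent:
  assumes "z \<in> I x y"
  shows "R x z z" "R y z z" "R z x x" "R z y y" "R x y y"
  using assms unfolding I_def by (auto intro: refl1 refl2 swap)

text \<open>A path from \<open>y\<close> off the closed neighborhood of \<open>z\<close> that met
  that of \<open>x\<close> would join \<open>x\<close> to \<open>y\<close>, making \<open>x\<close>,
  \<open>y\<close>, \<open>z\<close> an asteroidal triple. The vertex \<open>z\<close> makes the
  inclusion strict.\<close>

lemma comp_between_psubset:
  assumes "z \<in> I x y"
  shows "comp z y \<subset> comp x y"
proof
  have zx: "\<not> R z x y" and xzy: "R x z y"
    using assms no_triple[of z x y] sym unfolding I_def by blast+
  show "comp z y \<subseteq> comp x y"
    using avoid[OF I_nonadjacent(3)[OF assms] _ zx] by (auto simp: comp_def)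
  show "comp z y \<noteq> comp x y"
    using sym[OF xzy] irrefl(2) unfolding comp_def by blast
qed

section \<open>Turns of a walk outside a convex set\<close>

text \<open>Here \<open>z\<close> is a turn with labels \<open>y\<close> before and
  \<open>y'\<close> after it; \<open>l\<close> stands for any later label still in the component of
  \<open>y'\<close>. \<open>R l z y\<close> would put \<open>z\<close> between \<open>y\<close> and
  \<open>l\<close>, against convexity.\<close>

lemma labels_after_turn:
  assumes Y: "cvx Y" "y \<in> Y" "y' \<in> Y" and z: "z \<notin> Y" "R y z z"
    and w: "w \<in> I z y'" "w \<notin> Y" and sep: "\<not> R z y y'"
    and l: "l \<in> Y" "R z y' l"
  shows "R y z l \<and> \<not> R l z y \<and> \<not> R z y l"
proof -
  have zy: "R z y y" and zy': "R z y' y'"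
    using z(2) I_nonadjacent(5)[OF w(1)] by (auto intro: swap)
  have yy': "R y y' y'"
    using avoid[OF zy zy' sep] .
  have wzy': "R z w y'" and wy'z: "R y' w z"
    using w(1) by (auto simp: I_def)
  have wyy': "R y w y'"
    using avoid[OF zy sym[OF wzy']] sep sym by blast
  \<comment> \<open>Convexity keeps \<open>w\<close> out of \<open>I y y'\<close>, so
    \<open>y'\<close> separates \<open>z\<close> from \<open>y\<close>, and the path from
    \<open>z\<close> to \<open>w\<close> also misses the neighborhood of \<open>y\<close>.\<close>
  have yzy': "R y z y'"
  proof (rule ccontr)
    assume no: "\<not> R y z y'"
    have "\<not> R y' z y"
    proof
      assume "R y' z y"
      then have "w \<in> I y y'"
        using wyy' wy'z trans by (auto simp: I_def)
      then show False using Y w(2) by (auto simp: cvx_def)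
    qed
    then have "R y z w"
      using avoid[OF swap[OF yy'] sym[OF wy'z]] sym by blast
    then show False using no wyy' trans by blast
  qed
  have "R y y' l"
    using avoid[OF zy l(2) sep] .
  then have 1: "R y z l" using yzy' trans by blast
  have "\<not> R l z y"
  proof
    assume "R l z y"
    then have "z \<in> I y l" using 1 by (auto simp: I_def)
    then show False using Y l z by (auto simp: cvx_def)
  qed
  moreover have "\<not> R z y l" using sep l(2) sym trans by blast
  ultimately show ?thesis using 1 by blast
qed

text \<open>As \<open>l\<close> separates \<open>z\<close> from \<open>y\<close>, a path from
  \<open>y\<close> to \<open>u\<close> off the neighborhood of \<open>l\<close> would also miss that
  of \<open>z\<close>.\<close>

lemma separated_after_turn:
  assumes l: "R z l l" "\<not> R l z y" and u: "\<not> R z u y"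
  shows "\<not> R l u y"
  using avoid[OF swap[OF l(1)] _ l(2)] u sym by blast

text \<open>\<open>P\<close> is an invariant of the vertices of the walk, and \<open>E\<close> contains all labels.\<close>

lemma eventually_turns:
  assumes stuck: "\<And>x. x \<in> V - Y \<Longrightarrow> \<exists>y\<in>Y. \<not> I x y \<subseteq> Y"
    and no_turn: "\<And>l v l' w. P v \<Longrightarrow> l \<in> Y \<Longrightarrow> l \<in> E \<Longrightarrow> R l v v \<Longrightarrow> v \<notin> Y \<Longrightarrow> l' \<in> Y
      \<Longrightarrow> w \<in> I v l' \<Longrightarrow> w \<notin> Y \<Longrightarrow> R v l l'"
    and step: "\<And>x l v. P x \<Longrightarrow> l \<in> Y \<Longrightarrow> l \<in> E \<Longrightarrow> R l x v \<Longrightarrow> P v"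
    and start: "P x" "l \<in> Y" "comp x l \<subseteq> E" "v \<in> I x l" "v \<notin> Y"
  shows False
  using start
proof (induction "card (comp x l)" arbitrary: x l v rule: less_induct)
  case less
  have vlx: "R l x v" and vxl: "R x v l"
    using less.prems(4) sym by (auto simp: I_def)
  have lE: "l \<in> E"
    using less.prems(3) refl2[OF vxl] by (auto simp: comp_def)
  have Pv: "P v"
    using step[OF less.prems(1,2) lE vlx] .
  have "v \<in> V - Y"
    using less.prems(4,5) I_in_V by blast
  then obtain l' w where l': "l' \<in> Y" and w: "w \<in> I v l'" "w \<notin> Y"
    using stuck by blast
  have "R v l l'"
    using no_turn[OF Pv less.prems(2) lE refl2[OF vlx] less.prems(5) l' w] .
  then have psub: "comp v l' \<subset> comp x l"
    using comp_between_psubset[OF less.prems(4)] comp_eq by metis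
  show False
  proof (rule less.hyps)
    show "card (comp v l') < card (comp x l)"
      using psub finite_comp psubset_card_mono by blast
    show "comp v l' \<subseteq> E" using psub less.prems(3) by blast
  qed (fact Pv l' w)+
qed

text \<open>After a turn at \<open>z\<close>, the next turn would have a smaller component and is
  excluded by induction; the walk from \<open>z\<close> on then contradicts
  \<open>eventually_turns\<close>.\<close>

lemma no_turn:
  assumes Y: "cvx Y"
    and stuck: "\<And>x. x \<in> V - Y \<Longrightarrow> \<exists>y\<in>Y. \<not> I x y \<subseteq> Y"
    and start: "y \<in> Y" "y' \<in> Y" "z \<notin> Y" "R y z z" "w \<in> I z y'" "w \<notin> Y"
  shows "R z y y'"
  using start
proof (induction "card (comp y z)" arbitrary: y y' z w rule: less_induct)
  case less
  show ?case
  proof (rule ccontr)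
    assume sep: "\<not> R z y y'"
    \<comment> \<open>The walk stays connected to \<open>z\<close> off the neighborhood of
      \<open>y\<close>, and is cut off from \<open>y\<close> by that of \<open>z\<close>.\<close>
    let ?P = "\<lambda>u. R y z u \<and> \<not> R z u y"
    note label = labels_after_turn[OF Y less.prems sep]
    have after: "\<not> R l u y" if "l \<in> Y" "R z y' l" "?P u" for l u
      using separated_after_turn[of z l y u] label[OF that(1,2)] refl2[OF that(2)] that(3) by blast
    have nonadj: "R l y y" if "l \<in> Y" "R z y' l" for l
      using label[OF that] swap refl2 by blast
    show False
    proof (rule eventually_turns[OF stuck, where P = ?P and E = "comp z y'" and x = z and l = y'
          and v = w])
      fix x l v assume x: "?P x" and l: "l \<in> Y" "l \<in> comp z y'" and lxv: "R l x v"
      have zl: "R z y' l" using l by (simp add: comp_def)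
      note lab = label[OF l(1) zl] and nxy = after[OF l(1) zl x]
      have "R y x v"
        using avoid[OF nonadj[OF l(1) zl] lxv] nxy sym by blast
      moreover have "\<not> R z v y"
      proof
        assume "R z v y"
        then have "R l y v"
          using avoid[of z l y v] lab sym zl refl2 by blast
        then show False using nxy lxv sym trans by blast
      qed
      ultimately show "?P v" using x trans by blast
    next
      fix l v l' w'
      assume v: "?P v" and l: "l \<in> Y" "l \<in> comp z y'" and "R l v v" "v \<notin> Y" "l' \<in> Y"
        "w' \<in> I v l'" "w' \<notin> Y"
      have zl: "R z y' l" using l by (simp add: comp_def)
      \<comment> \<open>\<open>l\<close> separates \<open>v\<close> from \<open>y\<close>, so paths
        from \<open>v\<close> that avoid the neighborhood of \<open>l\<close> also avoid that of
        \<open>y\<close>.\<close>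
      have sub: "comp l v \<subseteq> comp y z"
        using avoid[OF nonadj[OF l(1) zl]] after[OF l(1) zl v] v sym trans
        unfolding comp_def by blast
      have "l \<in> comp y z" "l \<notin> comp l v"
        using label[OF l(1) zl] irrefl(2) by (auto simp: comp_def)
      then have "comp l v \<subset> comp y z" using sub by blast
      then have "card (comp l v) < card (comp y z)"
        using finite_comp psubset_card_mono by blast
      then show "R v l l'"
        by (rule less.hyps) fact+
    qed (use less.prems irrefl in auto)
  qed
qed

section \<open>One-point extensions and anti-exchange\<close>

lemma exists_one_point_extension:
  assumes Y: "cvx Y" "Y \<noteq> V"
  shows "\<exists>x\<in>V - Y. cvx (insert x Y)"
proof (rule ccontr)
  assume none: "\<not> ?thesis"
  have stuck: "\<exists>y\<in>Y. \<not> I x y \<subseteq> Y" if x: "x \<in> V - Y" for x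
  proof (rule ccontr)
    assume "\<not> ?thesis"
    then have "I x y \<subseteq> Y" if "y \<in> Y" for y
      using that by blast
    moreover have "I x x = {}"
      using I_nonadjacent(5) irrefl by blast
    ultimately have "cvx (insert x Y)"
      using Y x I_commute unfolding cvx_def by blast
    then show False using none x by blast
  qed
  obtain x where x: "x \<in> V - Y"
    using Y by (auto simp: cvx_def)
  then obtain y z where "y \<in> Y" "z \<in> I x y" "z \<notin> Y"
    using stuck by blast
  then show False
    \<comment> \<open>The invariant and the label set are trivial, since \<open>no_turn\<close>
      excludes turns everywhere.\<close>
    using eventually_turns[OF stuck, where P = "\<lambda>_. True" and E = UNIV]
      no_turn[OF Y(1) stuck] by blast
qed

lemma cvx_Inter:
  assumes "\<F> \<subseteq> Collect cvx" "\<F> \<noteq> {}"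
  shows "cvx (\<Inter>\<F>)"
  using assms unfolding cvx_def by blast

lemma convex_geometry_cvx: "convex_geometry V (Collect cvx)"
proof -
  have "x \<notin> cvx hull (Y \<union> {z})"
    if Y: "cvx Y" and x: "x \<in> V - Y" and z: "z \<in> V - Y" "x \<noteq> z"
      and zx: "z \<in> cvx hull (Y \<union> {x})" for Y x z
  proof
    assume xz: "x \<in> cvx hull (Y \<union> {z})"
    \<comment> \<open>A maximal member \<open>M\<close> can only be extended by \<open>x\<close>,
      which forces \<open>z\<close> into \<open>M\<close>.\<close>
    let ?A = "{W. cvx W \<and> Y \<subseteq> W \<and> x \<notin> W}"
    have "?A \<subseteq> Pow V" by (auto simp: cvx_def)
    then have "finite ?A" using finite_V finite_subset by blast
    moreover have "?A \<noteq> {}" using Y x by blast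
    ultimately have "\<exists>M\<in>?A. \<forall>W\<in>?A. M \<subseteq> W \<longrightarrow> M = W"
      by (rule finite_has_maximal)
    then obtain M where "M \<in> ?A" and max: "\<forall>W\<in>?A. M \<subseteq> W \<longrightarrow> M = W" ..
    then have M: "cvx M" "Y \<subseteq> M" "x \<notin> M" by simp_all
    obtain p where p: "p \<in> V - M" "cvx (insert p M)"
      using exists_one_point_extension[OF M(1)] M(3) x by blast
    have "x \<in> insert p M"
      using max p M(2) by auto
    then have xM: "cvx (insert x M)" using p(2) M(3) by blast
    have "cvx hull (Y \<union> {x}) \<subseteq> insert x M"
      using xM M(2) by (intro hull_minimal) auto
    then have "z \<in> M" using zx z by blast
    then have "cvx hull (Y \<union> {z}) \<subseteq> M"
      using M by (intro hull_minimal) auto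
    then show False using xz M(3) by blast
  qed
  moreover have "cvx V" "cvx {}" by (auto simp: cvx_def I_in_V)
  moreover have "Collect cvx \<subseteq> Pow V" by (auto simp: cvx_def)
  ultimately show ?thesis
    unfolding convex_geometry_def mem_Collect_eq
    by (intro conjI) (simp_all add: cvx_Inter)
qed

end

section \<open>Connection avoiding a set\<close>

definition arcs_avoiding :: "'a pair_pre_digraph \<Rightarrow> 'a set \<Rightarrow> 'a rel" where
  "arcs_avoiding G S = {(a, b) \<in> parcs G. a \<notin> S \<and> b \<notin> S}"

lemma vwalk_imp_rtrancl:
  assumes "vwalk p (with_proj G)" "set p \<inter> S = {}"
  shows "(hd p, last p) \<in> (arcs_avoiding G S)\<^sup>*"
  using assms
proof (induction p rule: vwalk_induct)
  case (Cons u v es)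
  then have "(u, v) \<in> arcs_avoiding G S" by (auto simp: arcs_avoiding_def)
  then show ?case using Cons by (auto intro: converse_rtrancl_into_rtrancl)
qed auto

text \<open>The closure relates even points of \<open>S\<close> to themselves; the condition on
  \<open>x\<close> rules this out.\<close>

lemma connected_avoiding_iff:
  assumes "pair_graph G"
  shows "connected_avoiding G S x y \<longleftrightarrow>
    x \<in> pverts G - S \<and> (x, y) \<in> (arcs_avoiding G S)\<^sup>*"
proof
  assume "connected_avoiding G S x y"
  then obtain p where p: "vwalk p (with_proj G)" "hd p = x" "last p = y" "set p \<inter> S = {}"
    by (auto simp: connected_avoiding_def vpath_def)
  moreover have "x \<in> set p" "set p \<subseteq> pverts G"
    using p by (auto simp: vwalk_def)
  ultimately show "x \<in> pverts G - S \<and> (x, y) \<in> (arcs_avoiding G S)\<^sup>*"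
    using vwalk_imp_rtrancl[of p G S] by blast
next
  interpret pair_graph G by fact
  assume xy: "x \<in> pverts G - S \<and> (x, y) \<in> (arcs_avoiding G S)\<^sup>*"
  then have "(x, y) \<in> (arcs_avoiding G S)\<^sup>*" by blast
  moreover have "y \<in> pverts G - S \<Longrightarrow> connected_avoiding G S x y" if "(x, y) \<in> (arcs_avoiding G S)\<^sup>*"
    using that
  proof (induction rule: converse_rtrancl_induct)
    case base
    then have "vpath [y] (with_proj G)" by auto
    with base show ?case
      unfolding connected_avoiding_def by (intro exI[of _ "[y]"]) auto
  next
    case (step a b)
    then obtain p where p: "vwalk p (with_proj G)" "hd p = b" "last p = y" "set p \<inter> S = {}"
      by (auto simp: connected_avoiding_def vpath_def)
    have ab: "(a, b) \<in> parcs G" "a \<notin> S"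
      using step by (auto simp: arcs_avoiding_def)
    have "p \<noteq> []" using p by (auto simp: vwalk_def)
    \<comment> \<open>Prepending \<open>a\<close> may repeat a vertex; \<open>vwalk_to_vpath\<close>
      shortens the walk and keeps its ends.\<close>
    have "vwalk (a # p) (with_proj G)"
      using p ab by (intro vwalk_consI) (auto dest: in_arcsD1)
    then have "vpath (vwalk_to_vpath (a # p)) (with_proj G)"
      by (rule vwalk_to_vpath_vpath)
    moreover have "set (vwalk_to_vpath (a # p)) \<inter> S = {}"
      using vwalk_to_vpath_subset[of _ "a # p"] p(4) ab(2)
      by (fastforce simp del: vwalk_to_vpath.simps)
    ultimately show ?case
      using p \<open>p \<noteq> []\<close> vwalk_to_vpath_hd[of "a # p"] vwalk_to_vpath_last[of "a # p"]
      unfolding connected_avoiding_def by (intro exI[of _ "vwalk_to_vpath (a # p)"]) auto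
  qed
  moreover have "y \<in> pverts G - S"
    using \<open>(x, y) \<in> (arcs_avoiding G S)\<^sup>*\<close> xy
    by (induction rule: rtrancl_induct) (auto simp: arcs_avoiding_def dest: in_arcsD2)
  ultimately show "connected_avoiding G S x y" by blast
qed

section \<open>AT-free graphs satisfy the separation axioms\<close>

lemma separation_connected_avoiding:
  assumes G: "pair_graph G" and AT: "AT_free G"
  shows "separation (pverts G)
    (\<lambda>c a b. c \<in> pverts G \<and> connected_avoiding G (closed_neighborhood G c) a b)"
    (is "separation ?V ?R")
proof -
  interpret pair_graph G by fact
  let ?N = "closed_neighborhood G"
  let ?E = "\<lambda>c. arcs_avoiding G (?N c)"
  have R: "?R c a b \<longleftrightarrow> c \<in> ?V \<and> a \<in> ?V - ?N c \<and> (a, b) \<in> (?E c)\<^sup>*" for c a b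
    using connected_avoiding_iff[OF G] by blast
  have parcs_sym: "(b, a) \<in> parcs G" if "(a, b) \<in> parcs G" for a b
    using that arcs_symmetric by auto
  have N_sym: "a \<in> ?N b \<longleftrightarrow> b \<in> ?N a" for a b
    unfolding closed_neighborhood_def neighborhood_def using parcs_sym by blast
  have E_sym: "sym (?E c)" for c
    unfolding arcs_avoiding_def using parcs_sym by (auto intro: symI)
  have end_V: "b \<in> ?V - ?N c" if "?R c a b" for c a b
  proof -
    have "(a, b) \<in> (?E c)\<^sup>*" "a \<in> ?V - ?N c" using that R by blast+
    then show ?thesis
      by (induction rule: rtrancl_induct) (auto simp: arcs_avoiding_def dest: in_arcsD2)
  qed
  have sym: "?R c b a" if "?R c a b" for a b c
    using that end_V[OF that] R sym_rtrancl[OF E_sym, of c] by (meson symD)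
  have trans: "?R c a d" if "?R c a b" "?R c b d" for a b c d
    using that R by (meson rtrancl_trans)
  \<comment> \<open>The conjunct \<open>c \<in> ?V\<close> in \<open>?R\<close> enters here, as
    \<open>c\<close> becomes an endpoint.\<close>
  have swap: "?R a c c" if "?R c a a" for a c
    using that R N_sym by blast
  have avoid: "?R a b d" if ca: "?R c a a" and bd: "?R c b d" and ab: "\<not> ?R c a b" for a b c d
  proof -
    have "(b, d) \<in> (?E c)\<^sup>*" using bd R by blast
    then show ?thesis
    proof (induction rule: rtrancl_induct)
      case base
      \<comment> \<open>Both \<open>a\<close> and \<open>b\<close> miss \<open>?N c\<close>, so
        equality or adjacency would connect them off it.\<close>
      have "b \<notin> ?N a"
      proof
        assume "b \<in> ?N a"
        then have "(a, b) \<in> (?E c)\<^sup>*"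
          using ca bd R by (auto simp: closed_neighborhood_def neighborhood_def arcs_avoiding_def)
        then show False using ca ab R by blast
      qed
      then show ?case using ca bd R by blast
    next
      case (step d e)
      have be: "?R c b e" using step.hyps bd R by (meson rtrancl.rtrancl_into_rtrancl)
      have "e \<notin> ?N a"
      proof
        assume "e \<in> ?N a"
        then have "(a, e) \<in> (?E c)\<^sup>*"
          using ca end_V[OF be] R
          by (auto simp: closed_neighborhood_def neighborhood_def arcs_avoiding_def)
        then have "?R c a e" using ca R by blast
        then show False using trans[OF _ sym[OF be]] ab by blast
      qed
      moreover have "d \<notin> ?N a" using end_V[OF step.IH] by blast
      ultimately have "(d, e) \<in> ?E a" using step.hyps by (auto simp: arcs_avoiding_def)
      then show ?case using step.IH R by (meson rtrancl.rtrancl_into_rtrancl)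
    qed
  qed
  have no_triple: "\<not> ?R b a c" if cab: "?R c a b" and abc: "?R a b c" for a b c
  proof
    assume bac: "?R b a c"
    have self: "x \<in> ?N x" for x by (simp add: closed_neighborhood_def)
    have dist: "a \<noteq> b" "a \<noteq> c" "b \<noteq> c"
    proof -
      have "a \<notin> ?N c" "b \<notin> ?N a" "c \<notin> ?N b"
        using cab abc end_V[OF abc] end_V[OF cab] end_V[OF bac] R by blast+
      then show "a \<noteq> b" "a \<noteq> c" "b \<noteq> c" using self by blast+
    qed
    have "asteroidal_triple G {a, b, c}"
      unfolding asteroidal_triple_def
    proof (intro conjI allI impI)
      show "{a, b, c} \<subseteq> ?V" "card {a, b, c} = 3"
        using cab abc bac dist by auto
      fix x y z assume eq: "{a, b, c} = {x, y, z}"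
      have "card {x, y, z} = 3" using dist by (simp add: eq[symmetric])
      then have "x \<noteq> y" "x \<noteq> z" "y \<noteq> z"
        by (auto simp: card_insert_if split: if_splits)
      moreover have "x \<in> {a, b, c}" "y \<in> {a, b, c}" "z \<in> {a, b, c}"
        unfolding eq by simp_all
      ultimately show "connected_avoiding G (?N z) x y"
        using cab abc bac sym[OF cab] sym[OF abc] sym[OF bac] by auto
    qed
    then show False using AT by (auto simp: AT_free_def)
  qed
  show ?thesis
  proof (unfold_locales)
    show "finite ?V" by (rule pair_finite_verts)
    show "a \<in> ?V" if "?R c a b" for a b c using that R by blast
  qed (fact sym trans swap avoid no_triple)+
qed

theorem theorem2p6:
  fixes G :: "'a pair_pre_digraph"
  assumes "pair_graph G" and "AT_free G"
  shows "convex_geometry (pverts G) {W. convex_set G W}"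
proof -
  let ?R = "\<lambda>c a b. c \<in> pverts G \<and> connected_avoiding G (closed_neighborhood G c) a b"
  interpret separation "pverts G" ?R
    using assms by (rule separation_connected_avoiding)
  have "between_set G u w = I u w" if "u \<in> pverts G" "w \<in> pverts G" for u w
    using that in_V by (auto simp: between_set_def between_def I_def)
  then have "convex_set G = cvx"
    unfolding convex_set_def cvx_def fun_eq_iff by (auto 0 3 simp: subset_iff)
  then show ?thesis using convex_geometry_cvx by simp
qed

end
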